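(* Let $N\ge1$ and $X=(x_1,\dots,x_N)$. For every $F\in\mathcal P$, the currents $\mathfrak e(z),\mathfrak f(z)$ act on the symmetric function $F[X]\in\mathcal P[X]$ by $$\mathfrak e(z)\,F[X]=\frac{q^{1/2}}{1-q}\,\frac{t^{-1/2}}{1-t^{-1}}\left\{t^{N/2}\frac{C(q^{1/2}t^{-1}z)}{C(q^{1/2}z)}-t^{-N/2}\frac{\widetilde C(q^{-1/2}tz^{-1})}{\widetilde C(q^{-1/2}z^{-1})}\right\}F\Big[X+\frac{q^{1/2}-q^{-1/2}}{z}\Big],$$ $$\mathfrak f(z)\,F[X]=\frac{q^{-1/2}}{1-q^{-1}}\,\frac{t^{1/2}}{1-t}\left\{t^{-N/2}\frac{C(q^{-1/2}tz)}{C(q^{-1/2}z)}-t^{N/2}\frac{\widetilde C(q^{1/2}t^{-1}z^{-1})}{\widetilde C(q^{1/2}z^{-1})}\right\}F\Big[X-\frac{q^{1/2}-q^{-1/2}}{z}\Big],$$ where ratios of $C$'s are expanded in nonnegative powers of $z$ and ratios of $\widetilde C$'s in nonnegative powers of $z^{-1}$.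
   Context: $q,t$ are indeterminates, $\theta=t^{1/2}$. $\Gamma_i$ is the shift $x_i\mapsto qx_i$. The currents are the formal series $$\mathfrak e(z)=\frac{q^{1/2}}{1-q}\sum_{n\in\mathbb Z}q^{n/2}z^n\sum_{i=1}^N x_i^n\prod_{j\ne i}\frac{\theta x_i-\theta^{-1}x_j}{x_i-x_j}\,\Gamma_i,$$ $$\mathfrak f(z)=\frac{q^{-1/2}}{1-q^{-1}}\sum_{n\in\mathbb Z}q^{-n/2}z^n\sum_{i=1}^N x_i^n\prod_{j\ne i}\frac{\theta^{-1}x_i-\theta x_j}{x_i-x_j}\,\Gamma_i^{-1}.$$ $\mathcal P$ is the space of functions that can be expressed as formal power series of the algebraically independent variables $p_k$, $k\in\mathbb Z\setminus\{0\}$. For $F\in\mathcal P$, $F[X]$ denotes the evaluation $p_k\mapsto p_k[X]=\sum_{i=1}^Nx_i^k$ in its power series, and $\mathcal P[X]$ is the space of functions of the form $F[X]$, $F\in\mathcal P$. The plethysm $F\big[X\pm\frac{q^{1/2}-q^{-1/2}}{z}\big]$ denotes the evaluation $p_k\mapsto p_k[X]\pm\frac{q^{k/2}-q^{-k/2}}{z^k}$ for all $k\in\mathbb Z\setminus\{0\}$. Finally $$C(z)=\prod_{i=1}^N(1-zx_i),\qquad \widetilde C(z)=\prod_{i=1}^N(1-zx_i^{-1}).$$ *)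

theory Defs
  imports
    "HOL-Analysis.Analysis"
    "HOL-Library.Poly_Mapping"
    "HOL-Computational_Algebra.Formal_Power_Series"
begin

text \<open>
  Conventions. All scalars live in one Hausdorff topological field. The parameters
  \<open>qh\<close> and \<open>\<theta>\<close> are the square roots of \<open>q\<close> and \<open>t\<close>, so that \<open>q = qh^2\<close> and \<open>t = \<theta>^2\<close>.
  The variables are \<open>x 1, \<dots>, x N\<close>; the operators \<open>\<Gamma>\<^sub>i\<close> act on functions of \<open>x\<close>. As the
  field is arbitrary, \<open>qh\<close>, \<open>\<theta>\<close> and the \<open>x i\<close> may in particular be indeterminates
  (elements of a field of rational functions).
\<close>

subsection \<open>Formal power series in the variables \<open>p\<^sub>k\<close> and their evaluation\<close>

text \<open>
  A monomial in the \<open>p\<^sub>k\<close> is its finitely supported exponent vector \<open>int \<Rightarrow>\<^sub>0 nat\<close>; the index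
  \<open>0\<close> is excluded. An element \<open>F\<close> of \<open>\<P>\<close> is its family of coefficients; only the values of
  \<open>F\<close> on \<open>p_monomials\<close> are ever used.
\<close>

definition p_monomials :: "(int \<Rightarrow>\<^sub>0 nat) set" where
  "p_monomials = {m. 0 \<notin> Poly_Mapping.keys m}"

definition eval_monomial :: "(int \<Rightarrow> 'b) \<Rightarrow> (int \<Rightarrow>\<^sub>0 nat) \<Rightarrow> 'b::comm_ring_1" where
  "eval_monomial p m = (\<Prod>k\<in>Poly_Mapping.keys m. p k ^ Poly_Mapping.lookup m k)"

definition power_sums :: "nat \<Rightarrow> (nat \<Rightarrow> 'a::field) \<Rightarrow> int \<Rightarrow> 'a" where
  "power_sums N x k = (\<Sum>i=1..N. x i powi k)"

definition converges_at ::
  "((int \<Rightarrow>\<^sub>0 nat) \<Rightarrow> 'a::{field, t2_space}) \<Rightarrow> nat \<Rightarrow> (nat \<Rightarrow> 'a) \<Rightarrow> bool" where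
  "converges_at F N x \<longleftrightarrow>
     (\<lambda>m. F m * eval_monomial (power_sums N x) m) summable_on p_monomials"

text \<open>The function \<open>F[X]\<close> of \<open>x\<close>; meaningful at \<open>x\<close> if \<open>converges_at F N x\<close>.\<close>

definition eval_X ::
  "((int \<Rightarrow>\<^sub>0 nat) \<Rightarrow> 'a::{field, t2_space}) \<Rightarrow> nat \<Rightarrow> (nat \<Rightarrow> 'a) \<Rightarrow> 'a" where
  "eval_X F N x = (\<Sum>\<^sub>\<infinity>m\<in>p_monomials. F m * eval_monomial (power_sums N x) m)"

subsection \<open>The currents\<close>

text \<open>
  A formal bilateral series in \<open>z\<close> is its coefficient function on \<open>int\<close>. The last two arguments
  of the currents are the power of \<open>z\<close> and the point \<open>x\<close>: \<open>current_e qh \<theta> N G n x\<close> is the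
  coefficient of \<open>z\<^sup>n\<close> of \<open>\<ee>(z) G\<close>, evaluated at \<open>x\<close>.
\<close>

definition shift_op :: "'a \<Rightarrow> nat \<Rightarrow> ((nat \<Rightarrow> 'a) \<Rightarrow> 'a) \<Rightarrow> (nat \<Rightarrow> 'a) \<Rightarrow> 'a::field" where
  "shift_op c i G x = G (x(i := c * x i))"

definition current_e ::
  "'a \<Rightarrow> 'a \<Rightarrow> nat \<Rightarrow> ((nat \<Rightarrow> 'a) \<Rightarrow> 'a) \<Rightarrow> int \<Rightarrow> (nat \<Rightarrow> 'a) \<Rightarrow> 'a::field" where
  "current_e qh \<theta> N G n x =
     qh / (1 - qh^2) * qh powi n *
     (\<Sum>i=1..N. x i powi n *
        (\<Prod>j\<in>{1..N} - {i}. (\<theta> * x i - inverse \<theta> * x j) / (x i - x j)) *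
        shift_op (qh^2) i G x)"

definition current_f ::
  "'a \<Rightarrow> 'a \<Rightarrow> nat \<Rightarrow> ((nat \<Rightarrow> 'a) \<Rightarrow> 'a) \<Rightarrow> int \<Rightarrow> (nat \<Rightarrow> 'a) \<Rightarrow> 'a::field" where
  "current_f qh \<theta> N G n x =
     inverse qh / (1 - inverse (qh^2)) * qh powi (- n) *
     (\<Sum>i=1..N. x i powi n *
        (\<Prod>j\<in>{1..N} - {i}. (inverse \<theta> * x i - \<theta> * x j) / (x i - x j)) *
        shift_op (inverse (qh^2)) i G x)"

subsection \<open>The series \<open>C\<close> and the expansions of their ratios\<close>

definition C_series :: "nat \<Rightarrow> (nat \<Rightarrow> 'a) \<Rightarrow> 'a::field fps" where
  "C_series N x = (\<Prod>i=1..N. 1 - fps_const (x i) * fps_X)"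

definition Ct_series :: "nat \<Rightarrow> (nat \<Rightarrow> 'a) \<Rightarrow> 'a::field fps" where
  "Ct_series N x = (\<Prod>i=1..N. 1 - fps_const (inverse (x i)) * fps_X)"

definition rescale :: "'a \<Rightarrow> 'a fps \<Rightarrow> 'a::field fps" where
  "rescale a f = fps_compose f (fps_const a * fps_X)"

text \<open>The bilateral series \<open>f(z)\<close> and \<open>f(z\<^sup>-\<^sup>1)\<close>.\<close>

definition in_z :: "'a::field fps \<Rightarrow> int \<Rightarrow> 'a" where
  "in_z f n = (if 0 \<le> n then fps_nth f (nat n) else 0)"

definition in_inv_z :: "'a::field fps \<Rightarrow> int \<Rightarrow> 'a" where
  "in_inv_z f n = (if n \<le> 0 then fps_nth f (nat (- n)) else 0)"

text \<open>The two bracketed differences; \<open>t\<^sup>N\<^sup>/\<^sup>2 = \<theta>\<^sup>N\<close>.\<close>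

definition bracket_e :: "'a \<Rightarrow> 'a \<Rightarrow> nat \<Rightarrow> (nat \<Rightarrow> 'a) \<Rightarrow> int \<Rightarrow> 'a::field" where
  "bracket_e qh \<theta> N x n =
     \<theta> ^ N * in_z (rescale (qh * inverse (\<theta>^2)) (C_series N x) / rescale qh (C_series N x)) n
   - inverse \<theta> ^ N * in_inv_z (rescale (inverse qh * \<theta>^2) (Ct_series N x)
                                / rescale (inverse qh) (Ct_series N x)) n"

definition bracket_f :: "'a \<Rightarrow> 'a \<Rightarrow> nat \<Rightarrow> (nat \<Rightarrow> 'a) \<Rightarrow> int \<Rightarrow> 'a::field" where
  "bracket_f qh \<theta> N x n =
     inverse \<theta> ^ N * in_z (rescale (inverse qh * \<theta>^2) (C_series N x)
                            / rescale (inverse qh) (C_series N x)) n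
   - \<theta> ^ N * in_inv_z (rescale (qh * inverse (\<theta>^2)) (Ct_series N x) / rescale qh (Ct_series N x)) n"

subsection \<open>Plethysm and its product with a bilateral series\<close>

text \<open>
  \<open>int \<Rightarrow>\<^sub>0 'a\<close> with the convolution product is the ring of Laurent polynomials in \<open>z\<close>. The
  plethystic substitutions replace \<open>p\<^sub>k\<close> by the following Laurent polynomials.
\<close>

definition pleth_plus :: "'a \<Rightarrow> nat \<Rightarrow> (nat \<Rightarrow> 'a) \<Rightarrow> int \<Rightarrow> (int \<Rightarrow>\<^sub>0 'a::field)" where
  "pleth_plus qh N x k =
     Poly_Mapping.single 0 (power_sums N x k)
   + Poly_Mapping.single (- k) (qh powi k - qh powi (- k))"

definition pleth_minus :: "'a \<Rightarrow> nat \<Rightarrow> (nat \<Rightarrow> 'a) \<Rightarrow> int \<Rightarrow> (int \<Rightarrow>\<^sub>0 'a::field)" where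
  "pleth_minus qh N x k =
     Poly_Mapping.single 0 (power_sums N x k)
   - Poly_Mapping.single (- k) (qh powi k - qh powi (- k))"

text \<open>Product of a bilateral series and a Laurent polynomial.\<close>

definition laurent_mult :: "(int \<Rightarrow> 'a) \<Rightarrow> (int \<Rightarrow>\<^sub>0 'a) \<Rightarrow> int \<Rightarrow> 'a::field" where
  "laurent_mult B L n = (\<Sum>j\<in>Poly_Mapping.keys L. B (n - j) * Poly_Mapping.lookup L j)"

text \<open>
  The product of a bilateral series \<open>B(z)\<close> and \<open>F[Y(z)]\<close>, where each \<open>Y k\<close> is a Laurent
  polynomial: every monomial of \<open>F\<close> is evaluated at \<open>Y\<close> and multiplied with \<open>B\<close>, and the
  resulting bilateral series are summed coefficientwise. Bilateral series are a module over
  Laurent polynomials but not a ring, so this is the product in which \<open>F[Y(z)]\<close> acts on \<open>B(z)\<close>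
  through its power series. For polynomial \<open>F\<close> it is the product with the Laurent polynomial
  \<open>F[Y(z)]\<close> (\<open>pleth_mult_polynomial\<close>), and it is the usual coefficientwise product of two
  bilateral series whenever the double series defining the latter is summable
  (\<open>pleth_mult_eq_convolution\<close>).
\<close>

definition pleth_mult ::
  "(int \<Rightarrow> 'a) \<Rightarrow> ((int \<Rightarrow>\<^sub>0 nat) \<Rightarrow> 'a) \<Rightarrow> (int \<Rightarrow> (int \<Rightarrow>\<^sub>0 'a)) \<Rightarrow> int \<Rightarrow> 'a::{field, t2_space}" where
  "pleth_mult B F Y n = (\<Sum>\<^sub>\<infinity>m\<in>p_monomials. F m * laurent_mult B (eval_monomial Y m) n)"

definition pleth_mult_converges ::
  "(int \<Rightarrow> 'a) \<Rightarrow> ((int \<Rightarrow>\<^sub>0 nat) \<Rightarrow> 'a) \<Rightarrow> (int \<Rightarrow> (int \<Rightarrow>\<^sub>0 'a::{field, t2_space})) \<Rightarrow> int \<Rightarrow> bool" where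
  "pleth_mult_converges B F Y n \<longleftrightarrow>
     (\<lambda>m. F m * laurent_mult B (eval_monomial Y m) n) summable_on p_monomials"

lemma laurent_mult_superset:
  assumes "finite S" "Poly_Mapping.keys L \<subseteq> S"
  shows "laurent_mult B L n = (\<Sum>j\<in>S. B (n - j) * Poly_Mapping.lookup L j)"
  unfolding laurent_mult_def using assms
  by (intro sum.mono_neutral_left) (auto simp: in_keys_iff)

lemma lookup_scalar_mult:
  fixes L :: "int \<Rightarrow>\<^sub>0 'a::field"
  shows "Poly_Mapping.lookup (Poly_Mapping.single 0 a * L) j = a * Poly_Mapping.lookup L j"
  unfolding mult_map_scale_conv_mult [symmetric] by (simp add: Poly_Mapping.map.rep_eq when_def)

lemma pleth_mult_polynomial:
  fixes F :: "(int \<Rightarrow>\<^sub>0 nat) \<Rightarrow> 'a::{field, t2_space}"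
  assumes fin: "finite M" and sub: "M \<subseteq> p_monomials" and zero: "\<And>m. m \<notin> M \<Longrightarrow> F m = 0"
  shows "pleth_mult B F Y n =
           laurent_mult B (\<Sum>m\<in>M. Poly_Mapping.single 0 (F m) * eval_monomial Y m) n"
proof -
  define S where "S = (\<Union>m\<in>M. Poly_Mapping.keys (eval_monomial Y m))"
  have S: "finite S" using fin by (simp add: S_def)
  let ?L = "\<Sum>m\<in>M. Poly_Mapping.single 0 (F m) * eval_monomial Y m"
  have lk: "Poly_Mapping.lookup ?L j = (\<Sum>m\<in>M. F m * Poly_Mapping.lookup (eval_monomial Y m) j)" for j
    by (simp add: lookup_sum lookup_scalar_mult)
  have "Poly_Mapping.keys ?L \<subseteq> S"
  proof
    fix j assume "j \<in> Poly_Mapping.keys ?L"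
    hence "Poly_Mapping.lookup ?L j \<noteq> 0"
      by (simp add: in_keys_iff)
    then obtain m where "m \<in> M" "F m * Poly_Mapping.lookup (eval_monomial Y m) j \<noteq> 0"
      unfolding lk by (rule sum.not_neutral_contains_not_neutral)
    thus "j \<in> S" by (auto simp: S_def in_keys_iff)
  qed
  hence "laurent_mult B ?L n =
      (\<Sum>j\<in>S. B (n - j) * (\<Sum>m\<in>M. F m * Poly_Mapping.lookup (eval_monomial Y m) j))"
    by (simp only: laurent_mult_superset [OF S] lk)
  also have "\<dots> = (\<Sum>m\<in>M. F m * (\<Sum>j\<in>S. B (n - j) * Poly_Mapping.lookup (eval_monomial Y m) j))"
    unfolding sum_distrib_left by (subst sum.swap) (simp only: mult.left_commute)
  also have "\<dots> = (\<Sum>m\<in>M. F m * laurent_mult B (eval_monomial Y m) n)"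
    by (intro sum.cong refl arg_cong [where f = "(*) _"] laurent_mult_superset [symmetric] S)
      (auto simp: S_def)
  also have "\<dots> = pleth_mult B F Y n"
    unfolding pleth_mult_def infsum_finite [OF fin, symmetric]
    by (rule infsum_cong_neutral) (use sub zero in auto)
  finally show ?thesis ..
qed

lemma pleth_mult_eq_convolution:
  fixes F :: "(int \<Rightarrow>\<^sub>0 nat) \<Rightarrow>
                'a::{field, t3_space, topological_semigroup_mult, topological_comm_monoid_add}"
    and Y :: "int \<Rightarrow> (int \<Rightarrow>\<^sub>0 'a)"
  defines "c \<equiv> \<lambda>m j. F m * Poly_Mapping.lookup (eval_monomial Y m) j"
  assumes coeffs: "\<And>j. (\<lambda>m. c m j) summable_on p_monomials"
    and joint: "(\<lambda>(m, j). B (n - j) * c m j) summable_on p_monomials \<times> UNIV"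
  shows "pleth_mult B F Y n = (\<Sum>\<^sub>\<infinity>j. B (n - j) * (\<Sum>\<^sub>\<infinity>m\<in>p_monomials. c m j))"
proof -
  obtain s where s: "((\<lambda>(m, j). B (n - j) * c m j) has_sum s) (p_monomials \<times> UNIV)"
    using joint by (auto simp: summable_on_def)
  have inner: "((\<lambda>j. B (n - j) * c m j) has_sum (F m * laurent_mult B (eval_monomial Y m) n)) UNIV"
    for m
  proof -
    let ?K = "Poly_Mapping.keys (eval_monomial Y m)"
    have "((\<lambda>j. B (n - j) * c m j) has_sum (\<Sum>j\<in>?K. B (n - j) * c m j)) ?K"
      by (rule has_sum_finite) simp
    also have "?this \<longleftrightarrow> ((\<lambda>j. B (n - j) * c m j) has_sum (\<Sum>j\<in>?K. B (n - j) * c m j)) UNIV"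
      by (rule has_sum_cong_neutral) (auto simp: c_def in_keys_iff)
    also have "(\<Sum>j\<in>?K. B (n - j) * c m j) = F m * laurent_mult B (eval_monomial Y m) n"
      by (simp add: laurent_mult_def c_def sum_distrib_left mult_ac)
    finally show ?thesis .
  qed
  have "((\<lambda>m. F m * laurent_mult B (eval_monomial Y m) n) has_sum s) p_monomials"
    by (rule has_sum_SigmaD [OF s]) (use inner in simp)
  moreover have "((\<lambda>(j, m). B (n - j) * c m j) has_sum s) (UNIV \<times> p_monomials)"
    using s by (subst (asm) has_sum_swap) simp
  hence "((\<lambda>j. B (n - j) * (\<Sum>\<^sub>\<infinity>m\<in>p_monomials. c m j)) has_sum s) UNIV"
    by (rule has_sum_SigmaD) (use coeffs in \<open>auto intro!: has_sum_cmult_right has_sum_infsum\<close>)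
  ultimately show ?thesis
    unfolding pleth_mult_def by (simp add: infsumI)
qed

end

theory Submission
  imports Defs "HOL-Computational_Algebra.Polynomial_FPS"
begin

text \<open>
  Partial fractions of \<open>\<Prod>\<^sub>i (a - b x\<^sub>i w) / (1 - x\<^sub>i w)\<close> show that the bracket is, up to a
  constant, the bilateral series \<open>\<Sum>\<^sub>i A\<^sub>i \<delta>(q\<^sup>1\<^sup>/\<^sup>2 x\<^sub>i z)\<close> with the
  coefficients \<open>A\<^sub>i\<close> of the current. A delta function absorbs Laurent polynomials by evaluation
  at \<open>z = (q\<^sup>1\<^sup>/\<^sup>2 x\<^sub>i)\<^sup>-\<^sup>1\<close>, and there the plethystic substitution becomes the
  shift of \<open>x\<^sub>i\<close>. The current \<open>\<ff>\<close> is \<open>\<ee>\<close> with \<open>q\<close> and \<open>t\<close> inverted.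
\<close>

section \<open>Partial fractions in polynomial form\<close>

text \<open>The coefficient is taken at \<open>card I\<close> and not as a leading coefficient
  because the degree drops when some \<open>c i\<close> is zero.\<close>

lemma prod_linear_poly:
  fixes a c :: "'b \<Rightarrow> 'a::field"
  assumes "finite I"
  shows "degree (\<Prod>i\<in>I. [:a i, c i:]) \<le> card I" (is ?deg)
    and "coeff (\<Prod>i\<in>I. [:a i, c i:]) (card I) = (\<Prod>i\<in>I. c i)" (is ?coeff)
proof -
  have "?deg \<and> ?coeff"
    using assms
  proof (induction I rule: finite_induct)
    case (insert k I)
    let ?P = "\<Prod>i\<in>I. [:a i, c i:]"
    have "degree ([:a k, c k:] * ?P) \<le> degree [:a k, c k:] + degree ?P"
      by (rule degree_mult_le)
    also have "\<dots> \<le> Suc (card I)"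
      using insert by (simp split: if_splits)
    finally show ?case
      using insert by (simp add: mult_pCons_left coeff_eq_0)
  qed simp
  then show ?deg ?coeff by auto
qed

text \<open>With \<open>a\<close> = \<theta> and \<open>b\<close> = 1/\<theta> this is the rational
  factor in the current e(z). Times \<open>a - b\<close> it is the coefficient of 1/(1 - x_i w) in
  the partial fractions of the product of (a - b x_j w)/(1 - x_j w); the factor \<open>a - b\<close>
  comes from j = i.\<close>

definition residue_coeff :: "'a \<Rightarrow> 'a \<Rightarrow> nat \<Rightarrow> (nat \<Rightarrow> 'a) \<Rightarrow> nat \<Rightarrow> 'a::field" where
  "residue_coeff a b N x i = (\<Prod>j\<in>{1..N} - {i}. (a * x i - b * x j) / (x i - x j))"

text \<open>This is the partial fraction expansion with denominators cleared; \<open>b ^ N\<close>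
  is the value of the rational function at infinity. Once the \<open>b ^ N\<close> term is moved to
  the left, both sides have degree at most N and vanishing coefficient of w^N, so agreement at the N
  distinct points 1/x_k suffices, as in Lagrange interpolation.\<close>

lemma partial_fractions_poly:
  fixes x :: "nat \<Rightarrow> 'a::field"
  assumes nz: "\<And>i. i \<in> {1..N} \<Longrightarrow> x i \<noteq> 0" and inj: "inj_on x {1..N}"
  shows "(\<Prod>i=1..N. [:a, - (b * x i):]) =
           smult (b ^ N) (\<Prod>i=1..N. [:1, - x i:]) +
           (\<Sum>i=1..N. smult ((a - b) * residue_coeff a b N x i) (\<Prod>j\<in>{1..N} - {i}. [:1, - x j:]))"
    (is "?L = smult _ ?C + ?R")
\<comment> \<open>For N = 0 the truncated difference \<open>N - 1\<close> is 0, and the bound on the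
  degree of the right-hand side would not give a degree below N.\<close>
proof (cases "N = 0")
  case False
  let ?D = "?L - smult (b ^ N) ?C"
  have "?D = ?R"
  proof (rule poly_eqI_degree_lead_coeff[where n = N and A = "(\<lambda>i. inverse (x i)) ` {1..N}"])
    let ?A = "(\<lambda>i. inverse (x i)) ` {1..N}"
    have "inj_on (\<lambda>i. inverse (x i)) {1..N}"
      using inj by (intro inj_onI) (simp add: inj_on_eq_iff)
    then have "card ?A = N"
      by (simp add: card_image)
    then show "N \<le> card ?A" by simp
    show "degree ?D \<le> N"
      using prod_linear_poly(1)[of "{1..N}" "\<lambda>_. a" "\<lambda>i. - (b * x i)"]
        prod_linear_poly(1)[of "{1..N}" "\<lambda>_. 1" "\<lambda>i. - x i"]
      by (intro degree_diff_le) (auto intro: order.trans[OF degree_smult_le])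
    have coeff_D: "coeff ?D N = 0"
    proof -
      have "(\<Prod>i=1..N. - (b * x i)) = b ^ N * (\<Prod>i=1..N. - x i)"
        using prod.distrib[of "\<lambda>_. b" "\<lambda>i. - x i" "{1..N}"] by simp
      then show ?thesis
        using prod_linear_poly(2)[of "{1..N}" "\<lambda>_. a" "\<lambda>i. - (b * x i)"]
          prod_linear_poly(2)[of "{1..N}" "\<lambda>_. 1" "\<lambda>i. - x i"] by simp
    qed
    have "degree ?R \<le> N - 1"
    proof (rule degree_sum_le)
      fix i assume "i \<in> {1..N}"
      then show "degree (smult ((a - b) * residue_coeff a b N x i)
          (\<Prod>j\<in>{1..N} - {i}. [:1, - x j:])) \<le> N - 1"
        using prod_linear_poly(1)[of "{1..N} - {i}" "\<lambda>_. 1" "\<lambda>i. - x i"]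
        by (auto intro: order.trans[OF degree_smult_le])
    qed simp
    then have "degree ?R < N"
      using False by linarith
    then show "degree ?R \<le> N" and "coeff ?D N = coeff ?R N"
      using coeff_D by (simp_all only: coeff_eq_0 less_imp_le)
  next
    fix w assume "w \<in> (\<lambda>i. inverse (x i)) ` {1..N}"
    then obtain k where k: "k \<in> {1..N}" and w: "w = inverse (x k)"
      by blast
    \<comment> \<open>At w = 1/x_k every product containing the factor with index k is zero. This
      removes the \<open>b ^ N\<close> term on the left and all summands but the k-th on the
      right.\<close>
    have vanish: "(\<Prod>j\<in>J. 1 - w * x j) = 0" if "finite J" "k \<in> J" for J
      using that k nz by (auto simp: w intro!: prod_zero bexI[of _ k])
    have "poly ?D w = (\<Prod>i=1..N. a - w * (b * x i))"
      using vanish[of "{1..N}"] k by (simp add: poly_prod)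
    also have "\<dots> = (a - b) * (\<Prod>j\<in>{1..N} - {k}. a - w * (b * x j))"
      using k nz by (subst prod.remove[of _ k]) (auto simp: w)
    also have "(\<Prod>j\<in>{1..N} - {k}. a - w * (b * x j)) =
        residue_coeff a b N x k * (\<Prod>j\<in>{1..N} - {k}. 1 - w * x j)"
      unfolding residue_coeff_def prod.distrib[symmetric]
    proof (rule prod.cong)
      fix j assume j: "j \<in> {1..N} - {k}"
      with k inj have "x k \<noteq> x j" by (auto simp: inj_on_eq_iff)
      then show "a - w * (b * x j) = (a * x k - b * x j) / (x k - x j) * (1 - w * x j)"
        using nz[OF k] by (simp add: w field_simps)
    qed simp
    also have "(a - b) * (residue_coeff a b N x k * (\<Prod>j\<in>{1..N} - {k}. 1 - w * x j)) =
        (\<Sum>i=1..N. (a - b) * residue_coeff a b N x i * (\<Prod>j\<in>{1..N} - {i}. 1 - w * x j))"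
    proof -
      have "(\<Sum>i\<in>{1..N} - {k}. (a - b) * residue_coeff a b N x i *
          (\<Prod>j\<in>{1..N} - {i}. 1 - w * x j)) = 0"
      proof (intro sum.neutral ballI)
        fix i assume "i \<in> {1..N} - {k}"
        then have "(\<Prod>j\<in>{1..N} - {i}. 1 - w * x j) = 0"
          by (intro vanish) (use k in auto)
        then show "(a - b) * residue_coeff a b N x i * (\<Prod>j\<in>{1..N} - {i}. 1 - w * x j) = 0"
          by (simp only: mult_zero_right)
      qed
      then show ?thesis
        by (subst sum.remove[OF finite_atLeastAtMost k]) (simp only: add_0_right mult.assoc)
    qed
    also have "\<dots> = poly ?R w"
      by (simp add: poly_sum poly_prod)
    finally show "poly ?D w = poly ?R w" .
  qed
  then show ?thesis by (simp only: diff_eq_eq add.commute)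
qed simp

section \<open>Power series expansion of the ratios of \<open>C_series\<close>\<close>

lemma fps_prod_nth_0: "fps_nth (\<Prod>i\<in>I. f i) 0 = (\<Prod>i\<in>I. fps_nth (f i) 0)"
  by (induction I rule: infinite_finite_induct) simp_all

lemma rescale_C_series:
  "rescale c (C_series N x) = (\<Prod>i=1..N. 1 - fps_const (c * x i) * fps_X)"
  unfolding rescale_def C_series_def
  by (simp add: fps_compose_prod_distrib fps_compose_sub_distrib fps_compose_mult_distrib
      mult.assoc[symmetric] mult.commute[of c])

lemma one_minus_const_fps_X_mult_geometric:
  "(1 - fps_const c * fps_X) * Abs_fps (\<lambda>n. c ^ n) = (1 :: 'a::field fps)"
proof (rule fps_ext)
  fix n show "fps_nth ((1 - fps_const c * fps_X) * Abs_fps (\<lambda>n. c ^ n)) n = fps_nth (1 :: 'a fps) n"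
    by (cases n) (simp_all add: left_diff_distrib mult.assoc)
qed

text \<open>Each factor is a quotient of two linear forms, hence homogeneous of degree zero.\<close>

lemma residue_coeff_scale:
  assumes "c \<noteq> 0"
  shows "residue_coeff a b N (\<lambda>i. c * x i) k = residue_coeff a b N x k"
proof -
  have "(a * (c * u) - b * (c * v)) / (c * u - c * v) = (a * u - b * v) / (u - v)" for u v
    using assms mult_divide_mult_cancel_left[of c "a * u - b * v" "u - v"]
    by (simp add: algebra_simps)
  then show ?thesis by (simp add: residue_coeff_def)
qed

text \<open>Multiplying numerator and denominator of each factor by x_k x_j exchanges the roles of
  \<open>a\<close> and \<open>b\<close>. This matches the coefficients of the expansion in 1/z with
  those of the expansion in z.\<close>

lemma residue_coeff_inverse:
  fixes x :: "nat \<Rightarrow> 'a::field"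
  assumes "\<And>i. i \<in> {1..N} \<Longrightarrow> x i \<noteq> 0" and "k \<in> {1..N}" and "inj_on x {1..N}"
  shows "residue_coeff a b N (\<lambda>i. inverse (x i)) k = residue_coeff b a N x k"
  unfolding residue_coeff_def
proof (rule prod.cong)
  fix j assume j: "j \<in> {1..N} - {k}"
  then have "x j \<noteq> 0" "x k \<noteq> 0" "x k - x j \<noteq> 0" "x j - x k \<noteq> 0"
    using assms by (auto simp: inj_on_eq_iff)
  then show "(a * inverse (x k) - b * inverse (x j)) / (inverse (x k) - inverse (x j)) =
      (b * x k - a * x j) / (x k - x j)"
    by (simp add: divide_simps) (simp add: algebra_simps)
qed simp

text \<open>The prefactor \<open>a ^ N\<close> turns the numerator factors 1 - c d x_i z into a - b
  y_i z with y_i = c x_i, so partial fractions give a constant plus geometric series in y_i z. The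
  form \<open>a * d = b\<close> covers the ratios of both \<open>C_series\<close> and
  \<open>Ct_series\<close>, with d = 1/\<theta>^2 and d = \<theta>^2.\<close>

lemma C_ratio_nth:
  fixes x :: "nat \<Rightarrow> 'a::field"
  assumes nz: "\<And>i. i \<in> {1..N} \<Longrightarrow> x i \<noteq> 0" and inj: "inj_on x {1..N}"
    and c: "c \<noteq> 0" and d: "a * d = b"
  shows "a ^ N * fps_nth (rescale (c * d) (C_series N x) / rescale c (C_series N x)) n =
           (if n = 0 then b ^ N else 0) +
           (a - b) * (\<Sum>i=1..N. (c * x i) ^ n * residue_coeff a b N x i)"
proof -
  define y where "y i = c * x i" for i
  define g where "g u = Abs_fps (\<lambda>n. u ^ n)" for u :: 'a
  define r where "r i = (a - b) * residue_coeff a b N y i" for i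
  let ?den = "\<lambda>i. 1 - fps_const (y i) * fps_X"
  let ?S = "fps_const (b ^ N) + (\<Sum>i=1..N. fps_const (r i) * g (y i))"
  have lin: "fps_of_poly [:u, - v:] = fps_const u - fps_const v * fps_X" for u v :: 'a
    by (simp add: fps_of_poly_pCons)
  have "fps_const (a ^ N) * rescale (c * d) (C_series N x) =
      (\<Prod>i=1..N. fps_const a * (1 - fps_const (c * d * x i) * fps_X))"
    by (simp add: rescale_C_series prod.distrib fps_const_power)
  also have "\<dots> = (\<Prod>i=1..N. fps_const a - fps_const (b * y i) * fps_X)"
  proof (rule prod.cong)
    fix i
    have "a * (c * d * x i) = b * y i"
      by (simp add: y_def d[symmetric])
    then show "fps_const a * (1 - fps_const (c * d * x i) * fps_X) =
        fps_const a - fps_const (b * y i) * fps_X"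
      by (simp add: right_diff_distrib mult.assoc[symmetric])
  qed simp
  \<comment> \<open>The partial fractions rest on evaluation at points, hence on polynomials;
    \<open>fps_of_poly\<close> carries the identity over to power series.\<close>
  also have "\<dots> = fps_of_poly (\<Prod>i=1..N. [:a, - (b * y i):])"
    by (simp add: fps_of_poly_prod lin)
  also have "(\<Prod>i=1..N. [:a, - (b * y i):]) = smult (b ^ N) (\<Prod>i=1..N. [:1, - y i:]) +
           (\<Sum>i=1..N. smult (r i) (\<Prod>j\<in>{1..N} - {i}. [:1, - y j:]))"
    unfolding r_def by (rule partial_fractions_poly)
      (use nz c inj in \<open>auto simp: y_def inj_on_eq_iff intro!: inj_onI\<close>)
  also have "fps_of_poly \<dots> = fps_const (b ^ N) * (\<Prod>i=1..N. ?den i) +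
           (\<Sum>i=1..N. fps_const (r i) * (\<Prod>j\<in>{1..N} - {i}. ?den j))"
    by (simp add: fps_of_poly_add fps_of_poly_smult fps_of_poly_sum fps_of_poly_prod lin)
  \<comment> \<open>The geometric series \<open>g (y i)\<close> inverts the missing i-th factor, so
    the full denominator can be factored out of every summand.\<close>
  also have "(\<Sum>i=1..N. fps_const (r i) * (\<Prod>j\<in>{1..N} - {i}. ?den j)) =
      (\<Sum>i=1..N. fps_const (r i) * g (y i) * (\<Prod>j=1..N. ?den j))"
  proof (rule sum.cong)
    fix i assume i: "i \<in> {1..N}"
    have "(\<Prod>j=1..N. ?den j) = ?den i * (\<Prod>j\<in>{1..N} - {i}. ?den j)"
      using i by (subst prod.remove[of _ i]) auto
    then have "g (y i) * (\<Prod>j=1..N. ?den j) = (?den i * g (y i)) * (\<Prod>j\<in>{1..N} - {i}. ?den j)"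
      by (simp only: mult_ac)
    then show "fps_const (r i) * (\<Prod>j\<in>{1..N} - {i}. ?den j) =
        fps_const (r i) * g (y i) * (\<Prod>j=1..N. ?den j)"
      by (simp add: g_def one_minus_const_fps_X_mult_geometric mult.assoc)
  qed simp
  also have "(\<Prod>j=1..N. ?den j) = rescale c (C_series N x)"
    by (simp add: rescale_C_series y_def)
  finally have eq: "fps_const (a ^ N) * rescale (c * d) (C_series N x) = ?S * rescale c (C_series N x)"
    by (simp add: distrib_right sum_distrib_right)
  have unit: "fps_nth (rescale c (C_series N x)) 0 \<noteq> 0"
    by (simp add: rescale_C_series fps_prod_nth_0)
  then have quot: "fps_const (a ^ N) * (rescale (c * d) (C_series N x) / rescale c (C_series N x)) = ?S"
    using eq unit by (simp add: fps_divide_unit mult.assoc[symmetric] inverse_mult_eq_1')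
  have "residue_coeff a b N y = residue_coeff a b N x"
    unfolding y_def[abs_def] by (rule ext) (rule residue_coeff_scale[OF c])
  then show ?thesis
    using arg_cong[OF quot, of "\<lambda>f. fps_nth f n"]
    by (simp add: fps_sum_nth g_def r_def y_def sum_distrib_left mult_ac)
qed

section \<open>The bracket as a sum of delta functions\<close>

text \<open>The two terms of the bracket are the expansions at z = 0 and at z = infinity of one
  rational function, the product of (\<theta> - u_i z/\<theta>)/(1 - u_i z) with u_i =
  \<open>qh * x i\<close>. Their difference therefore only sees the simple poles, and each pole
  contributes a multiple of the bilateral geometric series in u_i z.\<close>

lemma bracket_e_eq:
  fixes x :: "nat \<Rightarrow> 'a::field"
  assumes nz: "\<And>i. i \<in> {1..N} \<Longrightarrow> x i \<noteq> 0" and inj: "inj_on x {1..N}"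
    and qh: "qh \<noteq> 0" and \<theta>: "\<theta> \<noteq> 0"
  shows "bracket_e qh \<theta> N x n =
    (\<Sum>i=1..N. (\<theta> - inverse \<theta>) * residue_coeff \<theta> (inverse \<theta>) N x i * (qh * x i) powi n)"
    (is "_ = ?R n")
proof -
  let ?E = "rescale (qh * inverse (\<theta>^2)) (C_series N x) / rescale qh (C_series N x)"
  let ?Et = "rescale (inverse qh * \<theta>^2) (Ct_series N x) / rescale (inverse qh) (Ct_series N x)"
  have Ct: "Ct_series N x = C_series N (\<lambda>i. inverse (x i))"
    by (simp add: C_series_def Ct_series_def)
  have E: "\<theta> ^ N * fps_nth ?E m = (if m = 0 then inverse \<theta> ^ N else 0) + ?R (int m)" for m
    using \<theta> by (subst C_ratio_nth[where a = \<theta> and b = "inverse \<theta>", OF nz inj qh])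
      (simp_all add: power2_eq_square sum_distrib_left mult_ac)
  \<comment> \<open>The previous expansion applies with \<open>qh\<close>, \<theta> and all x_i
    inverted. The two exchanges of \<theta> and 1/\<theta> in the residue coefficient cancel, while
    the factor 1/\<theta> - \<theta> gives the sign. The extra constant does not appear as m >
    0.\<close>
  have Et: "inverse \<theta> ^ N * fps_nth ?Et m = - ?R (- int m)" if "m > 0" for m
  proof -
    have "inverse \<theta> ^ N * fps_nth ?Et m = (inverse \<theta> - \<theta>) *
        (\<Sum>i=1..N. (inverse qh * inverse (x i)) ^ m *
          residue_coeff (inverse \<theta>) \<theta> N (\<lambda>i. inverse (x i)) i)"
      unfolding Ct
      by (subst C_ratio_nth[where a = "inverse \<theta>" and b = \<theta>])
        (use that nz inj qh \<theta> in \<open>auto simp: power2_eq_square inj_on_eq_iff intro!: inj_onI\<close>)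
    also have "\<dots> = - ?R (- int m)"
      unfolding sum_distrib_left sum_negf[symmetric]
    proof (rule sum.cong)
      fix i assume "i \<in> {1..N}"
      then have "residue_coeff (inverse \<theta>) \<theta> N (\<lambda>i. inverse (x i)) i =
          residue_coeff \<theta> (inverse \<theta>) N x i"
        by (intro residue_coeff_inverse nz inj)
      then show "(inverse \<theta> - \<theta>) * ((inverse qh * inverse (x i)) ^ m *
            residue_coeff (inverse \<theta>) \<theta> N (\<lambda>i. inverse (x i)) i) =
          - ((\<theta> - inverse \<theta>) * residue_coeff \<theta> (inverse \<theta>) N x i * (qh * x i) powi (- int m))"
        by (simp add: power_int_minus power_inverse algebra_simps)
    qed simp
    finally show ?thesis .
  qed
  \<comment> \<open>Needed for n = 0, the only exponent that both expansions contain: the second one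
    contributes exactly the constant \<theta>^(-N) that is left over from the first.\<close>
  have nth_0: "fps_nth (rescale c (C_series N y) / rescale d (C_series N y)) 0 = 1" for c d and y :: "nat \<Rightarrow> 'a"
    by (subst fps_divide_nth_0) (simp_all add: rescale_C_series fps_prod_nth_0)
  consider "n > 0" | "n = 0" | "n < 0" by linarith
  then show ?thesis
  proof cases
    case 1
    then show ?thesis
      using E[of "nat n"] by (simp add: bracket_e_def in_z_def in_inv_z_def)
  next
    case 2
    then show ?thesis
      using E[of 0] by (simp add: bracket_e_def in_z_def in_inv_z_def Ct nth_0)
  next
    case 3
    then show ?thesis
      using Et[of "nat (- n)"] by (simp add: bracket_e_def in_z_def in_inv_z_def)
  qed
qed

section \<open>Evaluation of Laurent polynomials and the plethystic substitution\<close>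

definition laurent_eval :: "'a \<Rightarrow> (int \<Rightarrow>\<^sub>0 'a) \<Rightarrow> 'a::field" where
  "laurent_eval w L = (\<Sum>j\<in>Poly_Mapping.keys L. Poly_Mapping.lookup L j * w powi j)"

lemma laurent_eval_superset:
  assumes "finite S" "Poly_Mapping.keys L \<subseteq> S"
  shows "laurent_eval w L = (\<Sum>j\<in>S. Poly_Mapping.lookup L j * w powi j)"
  unfolding laurent_eval_def using assms
  by (intro sum.mono_neutral_left) (auto simp: in_keys_iff)

lemma laurent_eval_add: "laurent_eval w (L + M) = laurent_eval w L + laurent_eval w M"
proof -
  let ?S = "Poly_Mapping.keys L \<union> Poly_Mapping.keys M"
  have "Poly_Mapping.keys (L + M) \<subseteq> ?S" by (rule Poly_Mapping.keys_add)
  then show ?thesis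
    by (simp add: laurent_eval_superset[of ?S] lookup_add distrib_right sum.distrib)
qed

lemma laurent_eval_single: "laurent_eval w (Poly_Mapping.single k c) = c * w powi k"
  by (subst laurent_eval_superset[of "{k}"]) auto

lemma laurent_eval_one: "laurent_eval w 1 = 1"
  using laurent_eval_single[of w 0 1] by simp

lemma laurent_eval_zero: "laurent_eval w 0 = 0"
  by (simp add: laurent_eval_def)

text \<open>Lets an induction over updates add one monomial at a time.\<close>

lemma update_eq_add_single:
  "k \<notin> Poly_Mapping.keys f \<Longrightarrow> Poly_Mapping.update k v f = f + Poly_Mapping.single k v"
  by (rule poly_mapping_eqI) (auto simp: lookup_update lookup_add lookup_single in_keys_iff)

text \<open>Additivity in each argument reduces this to two monomials, where it is the law of
  exponents for integer powers of a nonzero \<open>w\<close>.\<close>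

lemma laurent_eval_mult:
  assumes "w \<noteq> 0"
  shows "laurent_eval w (L * M) = laurent_eval w L * laurent_eval w M"
proof (induction L rule: update_induct)
  case (update L k u)
  have single: "laurent_eval w (Poly_Mapping.single k u * M) = u * w powi k * laurent_eval w M"
  proof (induction M rule: update_induct)
    case (update M l v)
    then show ?case
      using assms by (simp add: update_eq_add_single laurent_eval_add laurent_eval_single
          distrib_left mult_single power_int_add mult_ac)
  qed (simp add: laurent_eval_zero)
  then show ?case
    using update by (simp add: update_eq_add_single distrib_right laurent_eval_add
        laurent_eval_single)
qed (simp add: laurent_eval_zero)

lemma laurent_eval_eval_monomial:
  assumes "w \<noteq> 0"
  shows "laurent_eval w (eval_monomial Y m) = eval_monomial (\<lambda>k. laurent_eval w (Y k)) m"
proof -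
  have "laurent_eval w (f ^ n) = laurent_eval w f ^ n" for f and n :: nat
    by (induction n) (simp_all add: laurent_eval_one laurent_eval_mult assms)
  moreover have "laurent_eval w (\<Prod>k\<in>K. g k) = (\<Prod>k\<in>K. laurent_eval w (g k))" if "finite K"
    for K and g :: "int \<Rightarrow> _"
    using that by (induction K rule: finite_induct)
      (simp_all add: laurent_eval_one laurent_eval_mult assms)
  ultimately show ?thesis by (simp add: eval_monomial_def)
qed

text \<open>This is the rule \<delta>(uz) L(z) = \<delta>(uz) L(1/u): replacing n by n - j in u^n
  produces the factor u^(-j), the value of z^j at z = 1/u.\<close>

lemma laurent_mult_sum_powi:
  fixes u :: "'b \<Rightarrow> 'a::field"
  assumes "\<And>i. i \<in> I \<Longrightarrow> u i \<noteq> 0"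
  shows "laurent_mult (\<lambda>n. \<Sum>i\<in>I. c i * u i powi n) L n =
           (\<Sum>i\<in>I. c i * u i powi n * laurent_eval (inverse (u i)) L)"
  unfolding laurent_mult_def laurent_eval_def sum_distrib_left sum_distrib_right
proof (subst sum.swap, intro sum.cong refl)
  fix i j assume "i \<in> I"
  then show "c i * u i powi (n - j) * Poly_Mapping.lookup L j =
      c i * u i powi n * (Poly_Mapping.lookup L j * inverse (u i) powi j)"
    using assms by (simp add: power_int_diff power_int_inverse field_simps)
qed

text \<open>At z = 1/(q^(1/2) x_i) the added term (q^(k/2) - q^(-k/2)) z^(-k) becomes (q x_i)^k -
  x_i^k, which exchanges the i-th summand of the power sum for its shifted value.\<close>

lemma laurent_eval_pleth_plus:
  fixes x :: "nat \<Rightarrow> 'a::field"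
  assumes "i \<in> {1..N}" "x i \<noteq> 0" "qh \<noteq> 0"
  shows "laurent_eval (inverse (qh * x i)) (pleth_plus qh N x k) =
           power_sums N (x(i := qh^2 * x i)) k"
proof -
  have "(qh * x i) powi k * (qh powi k - qh powi (- k)) = (qh^2 * x i) powi k - x i powi k"
    using assms by (simp add: power_int_mult_distrib power_int_minus power2_eq_square field_simps)
  moreover have "inverse (qh * x i) powi (- k) = (qh * x i) powi k"
    by (simp add: power_int_minus power_int_inverse del: inverse_mult_distrib)
  moreover have "power_sums N y k = y i powi k + (\<Sum>j\<in>{1..N} - {i}. y j powi k)" for y :: "nat \<Rightarrow> 'a"
    unfolding power_sums_def using assms by (subst sum.remove[of _ i]) auto
  ultimately show ?thesis
    by (simp add: pleth_plus_def laurent_eval_add laurent_eval_single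
        mult.commute[of "_ - _"] del: inverse_mult_distrib)
qed

section \<open>The action of the current e(z)\<close>

lemma has_sum_sum:
  fixes f :: "'i \<Rightarrow> 'm \<Rightarrow> 'a::topological_comm_monoid_add"
  assumes "\<And>i. i \<in> I \<Longrightarrow> (f i has_sum s i) A"
  shows "((\<lambda>m. \<Sum>i\<in>I. f i m) has_sum (\<Sum>i\<in>I. s i)) A"
  using assms by (induction I rule: infinite_finite_induct) (auto intro!: has_sum_add has_sum_0)

text \<open>For each monomial of F the product with the bracket is a fixed linear combination of the
  values of that monomial at the N shifted points. Convergence of F at these points thus gives
  convergence of the product, and the finite sum over i can be taken out of the sum over
  monomials.\<close>

lemma current_e_plethysm:
  fixes x :: "nat \<Rightarrow> 'a::{field, t2_space, topological_semigroup_mult, topological_comm_monoid_add}"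
  assumes qh: "qh \<noteq> 0" and \<theta>: "\<theta> \<noteq> 0" "\<theta>^2 \<noteq> 1"
    and nz: "\<And>i. i \<in> {1..N} \<Longrightarrow> x i \<noteq> 0" and inj: "inj_on x {1..N}"
    and conv: "\<And>i. i \<in> {1..N} \<Longrightarrow> converges_at F N (x(i := qh^2 * x i))"
  shows "pleth_mult_converges (bracket_e qh \<theta> N x) F (pleth_plus qh N x) n"
    and "current_e qh \<theta> N (eval_X F N) n x =
           qh / (1 - qh^2) * (inverse \<theta> / (1 - inverse (\<theta>^2))) *
           pleth_mult (bracket_e qh \<theta> N x) F (pleth_plus qh N x) n"
proof -
  define s where "s i = x(i := qh^2 * x i)" for i
  define c where "c i = (\<theta> - inverse \<theta>) * residue_coeff \<theta> (inverse \<theta>) N x i" for i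
  have bracket: "bracket_e qh \<theta> N x = (\<lambda>n. \<Sum>i=1..N. c i * (qh * x i) powi n)"
    unfolding c_def by (rule ext, rule bracket_e_eq) (fact nz inj qh \<theta>)+
  have term_eq: "laurent_mult (bracket_e qh \<theta> N x) (eval_monomial (pleth_plus qh N x) m) n =
      (\<Sum>i=1..N. c i * (qh * x i) powi n * eval_monomial (power_sums N (s i)) m)" for m
    unfolding bracket
  proof (subst laurent_mult_sum_powi)
    show "(\<Sum>i=1..N. c i * (qh * x i) powi n *
          laurent_eval (inverse (qh * x i)) (eval_monomial (pleth_plus qh N x) m)) =
        (\<Sum>i=1..N. c i * (qh * x i) powi n * eval_monomial (power_sums N (s i)) m)"
    proof (rule sum.cong)
      fix i assume i: "i \<in> {1..N}"
      have "laurent_eval (inverse (qh * x i)) (eval_monomial (pleth_plus qh N x) m) =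
          eval_monomial (\<lambda>k. laurent_eval (inverse (qh * x i)) (pleth_plus qh N x k)) m"
        by (rule laurent_eval_eval_monomial) (use nz[OF i] qh in simp)
      also have "(\<lambda>k. laurent_eval (inverse (qh * x i)) (pleth_plus qh N x k)) = power_sums N (s i)"
        unfolding s_def by (intro ext laurent_eval_pleth_plus i nz qh)
      finally show "c i * (qh * x i) powi n *
          laurent_eval (inverse (qh * x i)) (eval_monomial (pleth_plus qh N x) m) =
        c i * (qh * x i) powi n * eval_monomial (power_sums N (s i)) m"
        by simp
    qed simp
  qed (use nz qh in simp)
  have "((\<lambda>m. \<Sum>i=1..N. c i * (qh * x i) powi n * (F m * eval_monomial (power_sums N (s i)) m))
      has_sum (\<Sum>i=1..N. c i * (qh * x i) powi n * eval_X F N (s i))) p_monomials"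
    by (intro has_sum_sum has_sum_cmult_right)
      (use conv in \<open>auto simp: converges_at_def eval_X_def s_def\<close>)
  then have hs: "((\<lambda>m. F m * laurent_mult (bracket_e qh \<theta> N x) (eval_monomial (pleth_plus qh N x) m) n)
      has_sum (\<Sum>i=1..N. c i * (qh * x i) powi n * eval_X F N (s i))) p_monomials"
    by (simp add: term_eq sum_distrib_left mult_ac)
  then show "pleth_mult_converges (bracket_e qh \<theta> N x) F (pleth_plus qh N x) n"
    unfolding pleth_mult_converges_def by (rule has_sum_imp_summable)
  \<comment> \<open>The prefactor t^(-1/2)/(1 - t^(-1)) is the inverse of \<theta> - 1/\<theta>, so
    it cancels the constant in \<open>c i\<close>.\<close>
  have "1 - inverse (\<theta>^2) \<noteq> 0"
    using \<theta> by simp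
  then have "inverse \<theta> / (1 - inverse (\<theta>^2)) * (\<theta> - inverse \<theta>) = 1"
    using \<theta>(1) by (simp add: power2_eq_square field_simps)
  then have c: "inverse \<theta> / (1 - inverse (\<theta>^2)) * (c i * v) = residue_coeff \<theta> (inverse \<theta>) N x i * v"
    for i v
    unfolding c_def by (metis mult.assoc mult_1)
  have "pleth_mult (bracket_e qh \<theta> N x) F (pleth_plus qh N x) n =
      (\<Sum>i=1..N. c i * (qh * x i) powi n * eval_X F N (s i))"
    unfolding pleth_mult_def by (rule infsumI) (rule hs)
  then have "inverse \<theta> / (1 - inverse (\<theta>^2)) *
        pleth_mult (bracket_e qh \<theta> N x) F (pleth_plus qh N x) n =
      (\<Sum>i=1..N. residue_coeff \<theta> (inverse \<theta>) N x i * ((qh * x i) powi n * eval_X F N (s i)))"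
    by (simp only: sum_distrib_left mult.assoc[of "c _"] c)
  also have "\<dots> = qh powi n * (\<Sum>i=1..N. x i powi n * residue_coeff \<theta> (inverse \<theta>) N x i *
      eval_X F N (s i))"
    by (simp add: sum_distrib_left power_int_mult_distrib mult_ac)
  finally show "current_e qh \<theta> N (eval_X F N) n x =
           qh / (1 - qh^2) * (inverse \<theta> / (1 - inverse (\<theta>^2))) *
           pleth_mult (bracket_e qh \<theta> N x) F (pleth_plus qh N x) n"
    by (simp only: mult.assoc current_e_def shift_op_def residue_coeff_def s_def)
qed

section \<open>The current f(z) by inversion of the parameters\<close>

lemma bracket_f_eq_bracket_e: "bracket_f qh \<theta> = bracket_e (inverse qh) (inverse \<theta>)"
  by (intro ext) (simp add: bracket_e_def bracket_f_def power_inverse)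

text \<open>The difference q^(k/2) - q^(-k/2) is odd under inversion of q.\<close>

lemma pleth_minus_eq_pleth_plus: "pleth_minus qh N x = pleth_plus (inverse qh) N x"
  by (rule ext) (simp add: pleth_minus_def pleth_plus_def power_int_inverse power_int_minus
      single_diff)

lemma current_f_eq_current_e: "current_f qh \<theta> = current_e (inverse qh) (inverse \<theta>)"
  by (intro ext) (simp add: current_e_def current_f_def power_inverse power_int_inverse
      power_int_minus)

theorem theorem4p3:
  fixes N :: nat
    and qh \<theta> :: "'a::{field, t2_space, topological_semigroup_mult, topological_comm_monoid_add}"
    and x :: "nat \<Rightarrow> 'a"
    and F :: "(int \<Rightarrow>\<^sub>0 nat) \<Rightarrow> 'a"
  assumes "N \<ge> 1"
    and "qh \<noteq> 0" "qh^2 \<noteq> 1" "\<theta> \<noteq> 0" "\<theta>^2 \<noteq> 1"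
    and "\<And>i. i \<in> {1..N} \<Longrightarrow> x i \<noteq> 0"
    and "inj_on x {1..N}"
  shows
    "((\<forall>i\<in>{1..N}. converges_at F N (x(i := qh^2 * x i))) \<longrightarrow>
       (\<forall>n. pleth_mult_converges (bracket_e qh \<theta> N x) F (pleth_plus qh N x) n \<and>
            current_e qh \<theta> N (eval_X F N) n x =
              qh / (1 - qh^2) * (inverse \<theta> / (1 - inverse (\<theta>^2))) *
              pleth_mult (bracket_e qh \<theta> N x) F (pleth_plus qh N x) n)) \<and>
     ((\<forall>i\<in>{1..N}. converges_at F N (x(i := inverse (qh^2) * x i))) \<longrightarrow>
       (\<forall>n. pleth_mult_converges (bracket_f qh \<theta> N x) F (pleth_minus qh N x) n \<and>
            current_f qh \<theta> N (eval_X F N) n x =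
              inverse qh / (1 - inverse (qh^2)) * (\<theta> / (1 - \<theta>^2)) *
              pleth_mult (bracket_f qh \<theta> N x) F (pleth_minus qh N x) n))"
proof (intro conjI impI allI)
  fix n assume conv: "\<forall>i\<in>{1..N}. converges_at F N (x(i := qh^2 * x i))"
  note e = current_e_plethysm[OF assms(2,4,5,6,7), of F n]
  show "pleth_mult_converges (bracket_e qh \<theta> N x) F (pleth_plus qh N x) n"
    by (rule e(1)) (use conv in auto)
  show "current_e qh \<theta> N (eval_X F N) n x =
      qh / (1 - qh^2) * (inverse \<theta> / (1 - inverse (\<theta>^2))) *
      pleth_mult (bracket_e qh \<theta> N x) F (pleth_plus qh N x) n"
    by (rule e(2)) (use conv in auto)
next
  fix n assume conv: "\<forall>i\<in>{1..N}. converges_at F N (x(i := inverse (qh^2) * x i))"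
  have "inverse qh \<noteq> 0" "inverse \<theta> \<noteq> 0" "(inverse \<theta>)^2 \<noteq> 1"
    using assms(2,4,5) by (simp_all add: power_inverse)
  note f = current_e_plethysm[OF this assms(6,7), of F n, unfolded power_inverse]
  show "pleth_mult_converges (bracket_f qh \<theta> N x) F (pleth_minus qh N x) n"
    unfolding bracket_f_eq_bracket_e pleth_minus_eq_pleth_plus
    by (rule f(1)) (use conv in auto)
  show "current_f qh \<theta> N (eval_X F N) n x =
      inverse qh / (1 - inverse (qh^2)) * (\<theta> / (1 - \<theta>^2)) *
      pleth_mult (bracket_f qh \<theta> N x) F (pleth_minus qh N x) n"
    unfolding bracket_f_eq_bracket_e pleth_minus_eq_pleth_plus current_f_eq_current_e
    using f(2) conv by simp
qed

end
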